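(* Let $T>0$, and let $\Omega$, $A_0$, $(\phi_j)_{j\in\mathbb{N}^*}$, $(\lambda_j)_{j\in\mathbb{N}^*}$, $(\theta_j^T)_{j\in\mathbb{N}^*}$ be as described in the context. Set $$\gamma_j(T)=\frac{e^{2\mathrm{Re}(\lambda_j)T}}{\int_0^T|\theta_j^T(t)|^2\,dt},\qquad j\in\mathbb{N}^*,$$ and assume that $$\sum_{j=1}^{+\infty}\frac{1}{\gamma_j(T)}<+\infty .$$ Then the problem $$\sup_{\|g\|_{L^2(\Omega)}=1}\ \inf_{j\in\mathbb{N}^*}\gamma_j(T)\left|\int_\Omega g(x)\overline{\phi_j(x)}\,dx\right|^2$$ (where the supremum is over $g\in L^2(\Omega,\mathbb{C})$ of norm $1$) has at least one solution, and $$\sup_{\|g\|_{L^2(\Omega)}=1}\ \inf_{j\in\mathbb{N}^*}\gamma_j(T)\left|\int_\Omega g(x)\overline{\phi_j(x)}\,dx\right|^2=\left(\sum_{k=1}^{+\infty}\frac{1}{\gamma_k(T)}\right)^{-1}.$$ Moreover, the set of solutions consists of all functions $g$ in $L^2(\Omega,\mathbb{C})$ that can be expanded as $$g=\sum_{j=1}^{+\infty}g_j\phi_j\qquad\text{with}\qquad|g_j|^2=\left(\sum_{k=1}^{+\infty}\frac{1}{\gamma_k(T)}\right)^{-1}\frac{1}{\gamma_j(T)}\quad\text{for every } j\in\mathbb{N}^* .$$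
   Context: $\mathbb{N}^*=\{1,2,3,\dots\}$. $\Omega$ is an open connected subset of $\mathbb{R}^n$. $A_0:D(A_0)\to L^2(\Omega,\mathbb{C})$ is a densely defined operator such that $-A_0$ generates a strongly continuous semigroup on $L^2(\Omega,\mathbb{C})$. There exists an orthonormal basis $(\phi_j)_{j\in\mathbb{N}^*}$ of $L^2(\Omega,\mathbb{C})$ consisting of eigenfunctions of $A_0$, associated with (complex) eigenvalues $(\lambda_j)_{j\in\mathbb{N}^*}$ such that $\mathrm{Re}(\lambda_1)\leq\cdots\leq\mathrm{Re}(\lambda_j)\leq\cdots$. $(\theta_j^T)_{j\in\mathbb{N}^*}$ is a sequence in $L^2(0,T)$ (assumed to exist) that is biorthogonal to the family $(t\mapsto e^{-\lambda_jt})_{j\geq1}$, i.e. $\int_0^Te^{-\lambda_jt}\theta_k^T(t)\,dt=\delta_{jk}$ for all $j,k\in\mathbb{N}^*$. A "solution" is a $g$ of norm $1$ at which the supremum is attained. *)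

theory Defs
  imports "HOL-Analysis.Analysis"
begin

text \<open>
  Elements of L\<open>\<^sup>2\<close>(M, C) are represented by functions; two functions that agree almost
  everywhere represent the same element. Operators therefore act on representatives, and have
  to be compatible with almost-everywhere equality.
\<close>

definition L2_space :: "'a measure \<Rightarrow> ('a \<Rightarrow> complex) set" where
  "L2_space M = {f. f \<in> borel_measurable M \<and> integrable M (\<lambda>x. (cmod (f x))\<^sup>2)}"

definition L2_inner :: "'a measure \<Rightarrow> ('a \<Rightarrow> complex) \<Rightarrow> ('a \<Rightarrow> complex) \<Rightarrow> complex" where
  "L2_inner M f g = (LINT x|M. f x * cnj (g x))"

text \<open>The integral of a non-integrable function is 0, so the norm is meaningful only on
  \<open>L2_space M\<close>; below it is only applied to elements of that space.\<close>

definition L2_norm :: "'a measure \<Rightarrow> ('a \<Rightarrow> complex) \<Rightarrow> real" where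
  "L2_norm M f = sqrt (LINT x|M. (cmod (f x))\<^sup>2)"

definition L2_eq :: "'a measure \<Rightarrow> ('a \<Rightarrow> complex) \<Rightarrow> ('a \<Rightarrow> complex) \<Rightarrow> bool" where
  "L2_eq M f g \<longleftrightarrow> (AE x in M. f x = g x)"

definition L2_tendsto ::
  "'a measure \<Rightarrow> ('i \<Rightarrow> 'a \<Rightarrow> complex) \<Rightarrow> ('a \<Rightarrow> complex) \<Rightarrow> 'i filter \<Rightarrow> bool" where
  "L2_tendsto M u f F \<longleftrightarrow> ((\<lambda>i. L2_norm M (\<lambda>x. u i x - f x)) \<longlongrightarrow> 0) F"

definition L2_expansion ::
  "'a measure \<Rightarrow> (nat \<Rightarrow> 'a \<Rightarrow> complex) \<Rightarrow> (nat \<Rightarrow> complex) \<Rightarrow> ('a \<Rightarrow> complex) \<Rightarrow> bool" where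
  "L2_expansion M \<phi> c g \<longleftrightarrow> L2_tendsto M (\<lambda>N x. \<Sum>j=1..N. c j * \<phi> j x) g sequentially"

definition L2_orthonormal_basis :: "'a measure \<Rightarrow> (nat \<Rightarrow> 'a \<Rightarrow> complex) \<Rightarrow> bool" where
  "L2_orthonormal_basis M \<phi> \<longleftrightarrow>
     (\<forall>j\<ge>1. \<phi> j \<in> L2_space M) \<and>
     (\<forall>j\<ge>1. \<forall>k\<ge>1. L2_inner M (\<phi> j) (\<phi> k) = (if j = k then 1 else 0)) \<and>
     (\<forall>f\<in>L2_space M. \<forall>e>0. \<exists>N c. L2_norm M (\<lambda>x. f x - (\<Sum>j=1..N. c j * \<phi> j x)) < e)"

text \<open>A possibly unbounded linear operator with domain \<open>D\<close>.\<close>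

definition L2_operator ::
  "'a measure \<Rightarrow> ('a \<Rightarrow> complex) set \<Rightarrow> (('a \<Rightarrow> complex) \<Rightarrow> ('a \<Rightarrow> complex)) \<Rightarrow> bool" where
  "L2_operator M D A \<longleftrightarrow>
     D \<subseteq> L2_space M \<and> (\<lambda>x. 0) \<in> D \<and>
     (\<forall>f\<in>D. A f \<in> L2_space M) \<and>
     (\<forall>f\<in>D. \<forall>g\<in>L2_space M. L2_eq M f g \<longrightarrow> g \<in> D \<and> L2_eq M (A f) (A g)) \<and>
     (\<forall>f\<in>D. \<forall>g\<in>D. (\<lambda>x. f x + g x) \<in> D \<and>
        L2_eq M (A (\<lambda>x. f x + g x)) (\<lambda>x. A f x + A g x)) \<and>
     (\<forall>c. \<forall>f\<in>D. (\<lambda>x. c * f x) \<in> D \<and> L2_eq M (A (\<lambda>x. c * f x)) (\<lambda>x. c * A f x))"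

definition L2_bounded_operator ::
  "'a measure \<Rightarrow> (('a \<Rightarrow> complex) \<Rightarrow> ('a \<Rightarrow> complex)) \<Rightarrow> bool" where
  "L2_bounded_operator M A \<longleftrightarrow> L2_operator M (L2_space M) A \<and>
     (\<exists>C. \<forall>f\<in>L2_space M. L2_norm M (A f) \<le> C * L2_norm M f)"

definition L2_densely_defined_operator ::
  "'a measure \<Rightarrow> ('a \<Rightarrow> complex) set \<Rightarrow> (('a \<Rightarrow> complex) \<Rightarrow> ('a \<Rightarrow> complex)) \<Rightarrow> bool" where
  "L2_densely_defined_operator M D A \<longleftrightarrow> L2_operator M D A \<and>
     (\<forall>f\<in>L2_space M. \<forall>e>0. \<exists>g\<in>D. L2_norm M (\<lambda>x. f x - g x) < e)"

definition L2_C0_semigroup ::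
  "'a measure \<Rightarrow> (real \<Rightarrow> ('a \<Rightarrow> complex) \<Rightarrow> ('a \<Rightarrow> complex)) \<Rightarrow> bool" where
  "L2_C0_semigroup M S \<longleftrightarrow>
     (\<forall>t\<ge>0. L2_bounded_operator M (S t)) \<and>
     (\<forall>f\<in>L2_space M. L2_eq M (S 0 f) f) \<and>
     (\<forall>s\<ge>0. \<forall>t\<ge>0. \<forall>f\<in>L2_space M. L2_eq M (S (s + t) f) (S s (S t f))) \<and>
     (\<forall>f\<in>L2_space M. L2_tendsto M (\<lambda>t. S t f) f (at_right 0))"

text \<open>\<open>B\<close> with domain \<open>D\<close> is the infinitesimal generator of \<open>S\<close>; the equation for \<open>D\<close>
  makes it the maximal domain.\<close>

definition L2_generator_of ::
  "'a measure \<Rightarrow> ('a \<Rightarrow> complex) set \<Rightarrow> (('a \<Rightarrow> complex) \<Rightarrow> ('a \<Rightarrow> complex)) \<Rightarrow>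
   (real \<Rightarrow> ('a \<Rightarrow> complex) \<Rightarrow> ('a \<Rightarrow> complex)) \<Rightarrow> bool" where
  "L2_generator_of M D B S \<longleftrightarrow>
     D = {f \<in> L2_space M. \<exists>h\<in>L2_space M.
            L2_tendsto M (\<lambda>t x. (S t f x - f x) / complex_of_real t) h (at_right 0)} \<and>
     (\<forall>f\<in>D. B f \<in> L2_space M \<and>
        L2_tendsto M (\<lambda>t x. (S t f x - f x) / complex_of_real t) (B f) (at_right 0))"

definition generates_L2_C0_semigroup ::
  "'a measure \<Rightarrow> ('a \<Rightarrow> complex) set \<Rightarrow> (('a \<Rightarrow> complex) \<Rightarrow> ('a \<Rightarrow> complex)) \<Rightarrow> bool" where
  "generates_L2_C0_semigroup M D B \<longleftrightarrow> (\<exists>S. L2_C0_semigroup M S \<and> L2_generator_of M D B S)"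

definition L2_eigenfunction ::
  "'a measure \<Rightarrow> ('a \<Rightarrow> complex) set \<Rightarrow> (('a \<Rightarrow> complex) \<Rightarrow> ('a \<Rightarrow> complex)) \<Rightarrow>
   complex \<Rightarrow> ('a \<Rightarrow> complex) \<Rightarrow> bool" where
  "L2_eigenfunction M D A \<mu> f \<longleftrightarrow>
     f \<in> D \<and> \<not> L2_eq M f (\<lambda>x. 0) \<and> L2_eq M (A f) (\<lambda>x. \<mu> * f x)"

definition biorthogonal_to_exponentials ::
  "real \<Rightarrow> (nat \<Rightarrow> complex) \<Rightarrow> (nat \<Rightarrow> real \<Rightarrow> complex) \<Rightarrow> bool" where
  "biorthogonal_to_exponentials T lam \<theta> \<longleftrightarrow>
     (\<forall>j\<ge>1. \<theta> j \<in> L2_space (lebesgue_on {0<..<T})) \<and>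
     (\<forall>j\<ge>1. \<forall>k\<ge>1. (LINT t|lebesgue_on {0<..<T}. exp (- lam j * complex_of_real t) * \<theta> k t)
        = (if j = k then 1 else 0))"

definition gamma_coeff ::
  "real \<Rightarrow> (nat \<Rightarrow> complex) \<Rightarrow> (nat \<Rightarrow> real \<Rightarrow> complex) \<Rightarrow> nat \<Rightarrow> real" where
  "gamma_coeff T lam \<theta> j =
     exp (2 * Re (lam j) * T) / (LINT t|lebesgue_on {0<..<T}. (cmod (\<theta> j t))\<^sup>2)"

definition L2_unit_sphere :: "'a measure \<Rightarrow> ('a \<Rightarrow> complex) set" where
  "L2_unit_sphere M = {g \<in> L2_space M. L2_norm M g = 1}"

text \<open>The functional and its supremum are taken in the extended reals, where infima and suprema
  always exist; over the reals, \<open>Sup\<close> of an unbounded set would be unspecified.\<close>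

definition design_functional ::
  "'a measure \<Rightarrow> (nat \<Rightarrow> real) \<Rightarrow> (nat \<Rightarrow> 'a \<Rightarrow> complex) \<Rightarrow> ('a \<Rightarrow> complex) \<Rightarrow> ereal" where
  "design_functional M \<gamma> \<phi> g = (INF j\<in>{1..}. ereal (\<gamma> j * (cmod (L2_inner M g (\<phi> j)))\<^sup>2))"

definition design_value ::
  "'a measure \<Rightarrow> (nat \<Rightarrow> real) \<Rightarrow> (nat \<Rightarrow> 'a \<Rightarrow> complex) \<Rightarrow> ereal" where
  "design_value M \<gamma> \<phi> = (SUP g\<in>L2_unit_sphere M. design_functional M \<gamma> \<phi> g)"

definition design_solutions ::
  "'a measure \<Rightarrow> (nat \<Rightarrow> real) \<Rightarrow> (nat \<Rightarrow> 'a \<Rightarrow> complex) \<Rightarrow> ('a \<Rightarrow> complex) set" where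
  "design_solutions M \<gamma> \<phi> =
     {g \<in> L2_unit_sphere M. design_functional M \<gamma> \<phi> g = design_value M \<gamma> \<phi>}"

end

theory Submission
  imports Defs
begin

text \<open>
  The argument is a rigidity argument for two series with sum 1. Let \<open>S = (\<Sum>k. 1 / \<gamma> k)\<close>
  and \<open>v = 1 / S\<close>. By Parseval, the numbers \<open>a j = \<bar>\<langle>g, \<phi> j\<rangle>\<bar>\<^sup>2\<close> of a unit vector \<open>g\<close> have
  sum 1, and so do the weights \<open>v / \<gamma> j\<close>. If the infimum of \<open>\<gamma> j * a j\<close> is at least \<open>v\<close>,
  then \<open>a j\<close> dominates \<open>v / \<gamma> j\<close> for every \<open>j\<close>; two series with the same sum, one of which
  dominates the other, coincide term by term. Hence \<open>a j = v / \<gamma> j\<close> for all \<open>j\<close>, and the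
  infimum is exactly \<open>v\<close>. So \<open>v\<close> is an upper bound, and the maximisers are the vectors
  whose coefficients have the prescribed moduli. Such vectors exist because
  \<open>v / \<gamma> j\<close> is summable: this is the Riesz--Fischer theorem. All of this is carried out in
  \<open>optimal_design\<close> for an arbitrary measure and positive \<open>\<gamma>\<close> with summable
  reciprocals.

  Positivity of \<open>\<gamma> j\<close> comes from biorthogonality (\<open>gamma_coeff_pos\<close>): a function that pairs
  to 1 with an exponential cannot vanish almost everywhere.

  The Hilbert space facts rest on two results. The first is the Pythagorean identity
  \<open>L2_norm_sq_residual\<close>, which gives the distance of \<open>f\<close> to any finite combination of
  orthonormal vectors; Bessel, Parseval and the uniqueness of expansion coefficients are read
  off from it. The second is the completeness of \<open>L\<^sup>2\<close> (\<open>L2_complete\<close>), which turns the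
  Cauchy sequence of partial sums into an actual function.
\<close>

section \<open>Square-integrable functions and their inner product\<close>

lemma L2_norm_nonneg: "0 \<le> L2_norm M f"
  unfolding L2_norm_def by simp

lemma L2_norm_sq: "(L2_norm M f)\<^sup>2 = (LINT x|M. (cmod (f x))\<^sup>2)"
  unfolding L2_norm_def by (subst real_sqrt_pow2) auto

lemma L2_space_measurable: "f \<in> L2_space M \<Longrightarrow> f \<in> borel_measurable M"
  by (simp add: L2_space_def)

lemma L2_space_integrable_sq: "f \<in> L2_space M \<Longrightarrow> integrable M (\<lambda>x. (cmod (f x))\<^sup>2)"
  by (simp add: L2_space_def)

lemma L2_space_zero: "(\<lambda>x. 0) \<in> L2_space M"
  by (simp add: L2_space_def)

lemma L2_space_mult: "f \<in> L2_space M \<Longrightarrow> (\<lambda>x. c * f x) \<in> L2_space M"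
  by (auto simp: L2_space_def norm_mult power_mult_distrib)

lemma L2_space_add:
  assumes "f \<in> L2_space M" "g \<in> L2_space M"
  shows "(\<lambda>x. f x + g x) \<in> L2_space M"
proof -
  note [measurable] = assms[THEN L2_space_measurable]
  have "integrable M (\<lambda>x. (cmod (f x + g x))\<^sup>2)"
  proof (rule Bochner_Integration.integrable_bound)
    show "integrable M (\<lambda>x. 2 * (cmod (f x))\<^sup>2 + 2 * (cmod (g x))\<^sup>2)"
      using assms[THEN L2_space_integrable_sq] by simp
    have "(cmod (f x + g x))\<^sup>2 \<le> 2 * (cmod (f x))\<^sup>2 + 2 * (cmod (g x))\<^sup>2" for x
    proof -
      have "(cmod (f x + g x))\<^sup>2 \<le> (cmod (f x) + cmod (g x))\<^sup>2"
        by (intro power_mono norm_triangle_ineq) auto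
      also have "\<dots> \<le> 2 * (cmod (f x))\<^sup>2 + 2 * (cmod (g x))\<^sup>2"
        using sum_squares_bound[of "cmod (f x)" "cmod (g x)"] by (simp add: power2_sum)
      finally show ?thesis .
    qed
    then show "AE x in M. norm ((cmod (f x + g x))\<^sup>2) \<le> norm (2 * (cmod (f x))\<^sup>2 + 2 * (cmod (g x))\<^sup>2)"
      by auto
  qed measurable
  then show ?thesis by (simp add: L2_space_def)
qed

lemma L2_space_diff:
  assumes "f \<in> L2_space M" "g \<in> L2_space M"
  shows "(\<lambda>x. f x - g x) \<in> L2_space M"
  using L2_space_add[OF assms(1) L2_space_mult[OF assms(2), of "-1"]] by simp

lemma L2_space_sum:
  assumes "finite J" "\<And>j. j \<in> J \<Longrightarrow> \<phi> j \<in> L2_space M"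
  shows "(\<lambda>x. \<Sum>j\<in>J. c j * \<phi> j x) \<in> L2_space M"
  using assms by (induction J rule: finite_induct) (auto simp: L2_space_zero L2_space_add L2_space_mult)

lemma integrable_mult_cnj:
  assumes "f \<in> L2_space M" "g \<in> L2_space M"
  shows "integrable M (\<lambda>x. f x * cnj (g x))"
proof -
  note [measurable] = assms[THEN L2_space_measurable]
  have [measurable]: "cnj \<in> borel_measurable borel"
    by (intro borel_measurable_continuous_onI continuous_intros)
  show ?thesis
  proof (rule Bochner_Integration.integrable_bound)
    show "integrable M (\<lambda>x. (cmod (f x))\<^sup>2 + (cmod (g x))\<^sup>2)"
      using assms[THEN L2_space_integrable_sq] by simp
    have "cmod (f x) * cmod (g x) \<le> (cmod (f x))\<^sup>2 + (cmod (g x))\<^sup>2" for x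
      using sum_squares_bound[of "cmod (f x)" "cmod (g x)"]
        mult_nonneg_nonneg[OF norm_ge_zero[of "f x"] norm_ge_zero[of "g x"]] by linarith
    then show "AE x in M. norm (f x * cnj (g x)) \<le> norm ((cmod (f x))\<^sup>2 + (cmod (g x))\<^sup>2)"
      by (auto simp: norm_mult)
  qed measurable
qed

lemma L2_inner_diff_mult:
  assumes "f \<in> L2_space M" "g \<in> L2_space M" "h \<in> L2_space M"
  shows "L2_inner M (\<lambda>x. f x - c * g x) h = L2_inner M f h - c * L2_inner M g h"
proof -
  have "L2_inner M (\<lambda>x. f x - c * g x) h = (LINT x|M. f x * cnj (h x) - c * (g x * cnj (h x)))"
    unfolding L2_inner_def by (simp add: algebra_simps)
  also have "\<dots> = L2_inner M f h - c * L2_inner M g h"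
    unfolding L2_inner_def using integrable_mult_cnj assms
    by (subst Bochner_Integration.integral_diff) auto
  finally show ?thesis .
qed

lemma L2_inner_self: "L2_inner M f f = complex_of_real ((L2_norm M f)\<^sup>2)"
  unfolding L2_inner_def L2_norm_sq complex_norm_square[symmetric] integral_complex_of_real by simp

text \<open>
  Completing the square in \<open>c\<close>. The right-hand side separates the best choice
  \<open>c = \<langle>f, g\<rangle>\<close> from the penalty for any other choice.
\<close>

lemma L2_norm_sq_diff_mult:
  assumes f: "f \<in> L2_space M" and g: "g \<in> L2_space M" and unit: "L2_inner M g g = 1"
  shows "(L2_norm M (\<lambda>x. f x - c * g x))\<^sup>2 =
    (L2_norm M f)\<^sup>2 - (cmod (L2_inner M f g))\<^sup>2 + (cmod (c - L2_inner M f g))\<^sup>2"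
proof -
  have int: "integrable M (\<lambda>x. Re (cnj c * (f x * cnj (g x))))"
    using integrable_mult_cnj[OF f g] by (intro integrable_Re integrable_mult_right)
  have pointwise: "(cmod (a - c * b))\<^sup>2
      = ((cmod a)\<^sup>2 - 2 * Re (cnj c * (a * cnj b))) + (cmod c)\<^sup>2 * (cmod b)\<^sup>2" for a b
    unfolding cmod_power2 by (simp add: power2_eq_square algebra_simps)
  have square: "(cmod (c - z))\<^sup>2 = (cmod z)\<^sup>2 - 2 * Re (cnj c * z) + (cmod c)\<^sup>2" for z
    using pointwise[of z 1] by (simp add: norm_minus_commute)
  have "(L2_norm M (\<lambda>x. f x - c * g x))\<^sup>2 = (LINT x|M. ((cmod (f x))\<^sup>2
      - 2 * Re (cnj c * (f x * cnj (g x)))) + (cmod c)\<^sup>2 * (cmod (g x))\<^sup>2)"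
    unfolding L2_norm_sq pointwise ..
  also have "\<dots> = (L2_norm M f)\<^sup>2 - 2 * Re (cnj c * L2_inner M f g) + (cmod c)\<^sup>2 * (L2_norm M g)\<^sup>2"
    unfolding L2_norm_sq L2_inner_def
    using int integrable_mult_cnj[OF f g] f g [THEN L2_space_integrable_sq]
      f [THEN L2_space_integrable_sq]
    by (simp add: integral_Re[symmetric] del: Re_complex_of_real complex_cnj_mult times_complex.simps)
  also have "(L2_norm M g)\<^sup>2 = 1"
    using unit unfolding L2_inner_self of_real_eq_1_iff .
  finally show ?thesis
    using square[of "L2_inner M f g"] by simp
qed

section \<open>Orthonormal systems, Bessel and Parseval\<close>

definition L2_orthonormal :: "'a measure \<Rightarrow> (nat \<Rightarrow> 'a \<Rightarrow> complex) \<Rightarrow> bool" where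
  "L2_orthonormal M \<phi> \<longleftrightarrow>
     (\<forall>j\<ge>1. \<phi> j \<in> L2_space M) \<and>
     (\<forall>j\<ge>1. \<forall>k\<ge>1. L2_inner M (\<phi> j) (\<phi> k) = (if j = k then 1 else 0))"

text \<open>
  Combinations of other basis vectors are invisible to \<open>\<phi> k\<close>; this is what lets the
  vectors be subtracted one at a time in the next identity.
\<close>

lemma L2_inner_residual:
  assumes on: "L2_orthonormal M \<phi>" and f: "f \<in> L2_space M"
    and "finite J" "J \<subseteq> {1..}" "k \<notin> J" "1 \<le> k"
  shows "L2_inner M (\<lambda>x. f x - (\<Sum>j\<in>J. c j * \<phi> j x)) (\<phi> k) = L2_inner M f (\<phi> k)"
  using assms(3-5)
proof (induction J rule: finite_induct)
  case empty
  show ?case by simp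
next
  case (insert i J)
  have res: "(\<lambda>x. f x - (\<Sum>j\<in>J. c j * \<phi> j x)) \<in> L2_space M"
    using on insert.hyps insert.prems by (intro L2_space_diff f L2_space_sum) (auto simp: L2_orthonormal_def)
  have "L2_inner M (\<lambda>x. f x - (\<Sum>j\<in>insert i J. c j * \<phi> j x)) (\<phi> k)
     = L2_inner M (\<lambda>x. (f x - (\<Sum>j\<in>J. c j * \<phi> j x)) - c i * \<phi> i x) (\<phi> k)"
    using insert.hyps by (simp add: algebra_simps)
  also have "\<dots> = L2_inner M (\<lambda>x. f x - (\<Sum>j\<in>J. c j * \<phi> j x)) (\<phi> k)"
    using on insert.prems \<open>1 \<le> k\<close> by (subst L2_inner_diff_mult[OF res]) (auto simp: L2_orthonormal_def)
  finally show ?case using insert by simp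
qed

text \<open>
  The coefficients \<open>c\<close> are arbitrary on purpose. With the Fourier coefficients of \<open>f\<close> the last
  sum vanishes, which gives Bessel's inequality; with other coefficients it measures how much
  worse the approximation is; and with \<open>f = 0\<close> it is the norm of a finite combination.
\<close>

lemma L2_norm_sq_residual:
  assumes on: "L2_orthonormal M \<phi>" and f: "f \<in> L2_space M"
    and "finite J" "J \<subseteq> {1..}"
  shows "(L2_norm M (\<lambda>x. f x - (\<Sum>j\<in>J. c j * \<phi> j x)))\<^sup>2 =
    (L2_norm M f)\<^sup>2 - (\<Sum>j\<in>J. (cmod (L2_inner M f (\<phi> j)))\<^sup>2)
      + (\<Sum>j\<in>J. (cmod (c j - L2_inner M f (\<phi> j)))\<^sup>2)"
  using assms(3,4)
proof (induction J rule: finite_induct)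
  case empty
  show ?case by simp
next
  case (insert i J)
  have res: "(\<lambda>x. f x - (\<Sum>j\<in>J. c j * \<phi> j x)) \<in> L2_space M"
    using on insert.hyps insert.prems by (intro L2_space_diff f L2_space_sum) (auto simp: L2_orthonormal_def)
  have inner: "L2_inner M (\<lambda>x. f x - (\<Sum>j\<in>J. c j * \<phi> j x)) (\<phi> i) = L2_inner M f (\<phi> i)"
    using insert by (intro L2_inner_residual[OF on f]) auto
  have "(\<lambda>x. f x - (\<Sum>j\<in>insert i J. c j * \<phi> j x))
      = (\<lambda>x. (f x - (\<Sum>j\<in>J. c j * \<phi> j x)) - c i * \<phi> i x)"
    using insert.hyps by (simp add: algebra_simps)
  then have "(L2_norm M (\<lambda>x. f x - (\<Sum>j\<in>insert i J. c j * \<phi> j x)))\<^sup>2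
      = (L2_norm M (\<lambda>x. f x - (\<Sum>j\<in>J. c j * \<phi> j x)))\<^sup>2
        - (cmod (L2_inner M f (\<phi> i)))\<^sup>2 + (cmod (c i - L2_inner M f (\<phi> i)))\<^sup>2"
    using L2_norm_sq_diff_mult[OF res, of "\<phi> i" "c i"] on insert.prems
    by (simp add: inner L2_orthonormal_def)
  then show ?case using insert by simp
qed

lemma Bessel_inequality:
  assumes "L2_orthonormal M \<phi>" "f \<in> L2_space M" "finite J" "J \<subseteq> {1..}"
  shows "(\<Sum>j\<in>J. (cmod (L2_inner M f (\<phi> j)))\<^sup>2) \<le> (L2_norm M f)\<^sup>2"
  using L2_norm_sq_residual[OF assms, of "\<lambda>j. L2_inner M f (\<phi> j)"]
    zero_le_power2[of "L2_norm M (\<lambda>x. f x - (\<Sum>j\<in>J. L2_inner M f (\<phi> j) * \<phi> j x))"]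
  by simp

text \<open>
  By the Pythagorean identity and Bessel, a wrong coefficient at \<open>k\<close> keeps every partial sum
  from index \<open>k\<close> on at least \<open>\<bar>c k - \<langle>f, \<phi> k\<rangle>\<bar>\<close> away from \<open>f\<close>.
\<close>

lemma L2_expansion_coeff:
  assumes on: "L2_orthonormal M \<phi>" and f: "f \<in> L2_space M"
    and exp: "L2_expansion M \<phi> c f" and "1 \<le> k"
  shows "c k = L2_inner M f (\<phi> k)"
proof -
  let ?r = "\<lambda>N. (L2_norm M (\<lambda>x. f x - (\<Sum>j=1..N. c j * \<phi> j x)))\<^sup>2"
  have "(\<lambda>N. L2_norm M (\<lambda>x. (\<Sum>j=1..N. c j * \<phi> j x) - f x)) \<longlonglongrightarrow> 0"
    using exp by (simp add: L2_expansion_def L2_tendsto_def)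
  from tendsto_power[OF this, of 2] have lim: "?r \<longlonglongrightarrow> 0"
    unfolding L2_norm_sq norm_minus_commute by simp
  have "(cmod (c k - L2_inner M f (\<phi> k)))\<^sup>2 \<le> ?r N" if "N \<ge> k" for N
  proof -
    have "(cmod (c k - L2_inner M f (\<phi> k)))\<^sup>2 \<le> (\<Sum>j=1..N. (cmod (c j - L2_inner M f (\<phi> j)))\<^sup>2)"
      using that \<open>1 \<le> k\<close> by (intro member_le_sum) auto
    moreover have "(\<Sum>j=1..N. (cmod (L2_inner M f (\<phi> j)))\<^sup>2) \<le> (L2_norm M f)\<^sup>2"
      using on f by (rule Bessel_inequality) auto
    moreover have "?r N = (L2_norm M f)\<^sup>2 - (\<Sum>j=1..N. (cmod (L2_inner M f (\<phi> j)))\<^sup>2)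
      + (\<Sum>j=1..N. (cmod (c j - L2_inner M f (\<phi> j)))\<^sup>2)"
      using on f by (rule L2_norm_sq_residual) auto
    ultimately show ?thesis by linarith
  qed
  then have "(cmod (c k - L2_inner M f (\<phi> k)))\<^sup>2 \<le> 0"
    by (intro tendsto_lowerbound[OF lim]) (auto simp: eventually_sequentially)
  then show ?thesis by simp
qed

text \<open>
  Density of the span provides, for each tolerance, some combination whose number of terms and
  coefficients are unspecified. Replacing the coefficients by Fourier coefficients, and adding
  further terms, can only decrease the distance, so the Fourier partial sums converge. Parseval
  is then the limit of the Pythagorean identity.
\<close>

lemma
  assumes basis: "L2_orthonormal_basis M \<phi>" and f: "f \<in> L2_space M"
  shows L2_expansion_Fourier: "L2_expansion M \<phi> (\<lambda>j. L2_inner M f (\<phi> j)) f"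
    and Parseval: "(\<lambda>j. (cmod (L2_inner M f (\<phi> (Suc j))))\<^sup>2) sums (L2_norm M f)\<^sup>2"
proof -
  have on: "L2_orthonormal M \<phi>"
    using basis by (simp add: L2_orthonormal_def L2_orthonormal_basis_def)
  define d where "d N = L2_norm M (\<lambda>x. f x - (\<Sum>j=1..N. L2_inner M f (\<phi> j) * \<phi> j x))" for N
  have d_sq: "(d N)\<^sup>2 = (L2_norm M f)\<^sup>2 - (\<Sum>j=1..N. (cmod (L2_inner M f (\<phi> j)))\<^sup>2)" for N
    unfolding d_def using L2_norm_sq_residual[OF on f, of "{1..N}"] by simp
  have d_nonneg: "0 \<le> d N" for N
    by (simp add: d_def L2_norm_nonneg)
  have d_lim: "d \<longlonglongrightarrow> 0"
  proof (rule LIMSEQ_I)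
    fix e :: real assume "0 < e"
    then obtain N c where Nc: "L2_norm M (\<lambda>x. f x - (\<Sum>j=1..N. c j * \<phi> j x)) < e"
      using basis f unfolding L2_orthonormal_basis_def by blast
    have "d n < e" if "n \<ge> N" for n
    proof -
      have "(\<Sum>j=1..N. (cmod (L2_inner M f (\<phi> j)))\<^sup>2) \<le> (\<Sum>j=1..n. (cmod (L2_inner M f (\<phi> j)))\<^sup>2)"
        using that by (intro sum_mono2) auto
      moreover have "0 \<le> (\<Sum>j=1..N. (cmod (c j - L2_inner M f (\<phi> j)))\<^sup>2)"
        by (intro sum_nonneg) auto
      ultimately have "(d n)\<^sup>2 \<le> (L2_norm M (\<lambda>x. f x - (\<Sum>j=1..N. c j * \<phi> j x)))\<^sup>2"
        using L2_norm_sq_residual[OF on f, of "{1..N}" c] d_sq[of n] by simp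
      then show ?thesis
        using Nc power2_le_imp_le[OF _ L2_norm_nonneg] by (meson le_less_trans)
    qed
    then show "\<exists>no. \<forall>n\<ge>no. norm (d n - 0) < e"
      using d_nonneg by auto
  qed
  have "d = (\<lambda>N. L2_norm M (\<lambda>x. (\<Sum>j=1..N. L2_inner M f (\<phi> j) * \<phi> j x) - f x))"
    by (simp add: d_def L2_norm_def norm_minus_commute fun_eq_iff)
  then show "L2_expansion M \<phi> (\<lambda>j. L2_inner M f (\<phi> j)) f"
    using d_lim by (simp add: L2_expansion_def L2_tendsto_def)
  have "(\<lambda>N. (L2_norm M f)\<^sup>2 - (d N)\<^sup>2) \<longlonglongrightarrow> (L2_norm M f)\<^sup>2 - 0\<^sup>2"
    by (intro tendsto_intros d_lim)
  moreover have "(L2_norm M f)\<^sup>2 - (d N)\<^sup>2 = (\<Sum>j<N. (cmod (L2_inner M f (\<phi> (Suc j))))\<^sup>2)" for N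
    unfolding d_sq by (simp add: sum.atLeast1_atMost_eq)
  ultimately show "(\<lambda>j. (cmod (L2_inner M f (\<phi> (Suc j))))\<^sup>2) sums (L2_norm M f)\<^sup>2"
    by (simp add: sums_def)
qed

section \<open>Completeness\<close>

lemma nn_integral_L2_norm:
  assumes "f \<in> L2_space M"
  shows "(\<integral>\<^sup>+x. ennreal ((cmod (f x))\<^sup>2) \<partial>M) = ennreal ((L2_norm M f)\<^sup>2)"
  unfolding L2_norm_sq using assms[THEN L2_space_integrable_sq] by (intro nn_integral_eq_integral) auto

text \<open>
  Fatou's lemma bounds nonnegative integrals; this converts such a bound into membership in
  \<open>L\<^sup>2\<close> and a norm estimate.
\<close>

lemma L2_norm_bound_from_nn_integral:
  assumes [measurable]: "f \<in> borel_measurable M" and "0 \<le> e"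
    and le: "(\<integral>\<^sup>+x. ennreal ((cmod (f x))\<^sup>2) \<partial>M) \<le> ennreal (e\<^sup>2)"
  shows "f \<in> L2_space M" and "L2_norm M f \<le> e"
proof -
  have "(\<integral>\<^sup>+x. ennreal ((cmod (f x))\<^sup>2) \<partial>M) < \<infinity>"
    using le by (simp add: le_less_trans)
  then show f: "f \<in> L2_space M"
    unfolding L2_space_def by (auto intro!: integrableI_nonneg)
  have "(L2_norm M f)\<^sup>2 \<le> e\<^sup>2"
    using le nn_integral_L2_norm[OF f] by (simp add: ennreal_le_iff)
  then show "L2_norm M f \<le> e"
    using \<open>0 \<le> e\<close> by (rule power2_le_imp_le)
qed

text \<open>
  The squares of the increments \<open>d k\<close> have integrals at most \<open>(1/4)^k\<close>, so even the weighted
  series \<open>\<Sum>k. 2^k * (d k)\<^sup>2\<close> has finite integral and therefore converges almost everywhere. The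
  weights matter: by the inequality \<open>2 * d \<le> 2^k * d\<^sup>2 + (1/2)^k\<close>, convergence of this series of
  squares yields absolute convergence of the series of increments, without appeal to
  Minkowski's inequality.
\<close>

lemma AE_convergent_if_rapidly_Cauchy:
  assumes L2: "\<And>k. v k \<in> L2_space M"
    and step: "\<And>k. L2_norm M (\<lambda>x. v (Suc k) x - v k x) \<le> (1/2)^k"
  shows "AE x in M. convergent (\<lambda>k. v k x)"
proof -
  note [measurable] = L2[THEN L2_space_measurable]
  let ?d = "\<lambda>k x. v (Suc k) x - v k x"
  have "(\<integral>\<^sup>+x. (\<Sum>k. ennreal (2^k * (cmod (?d k x))\<^sup>2)) \<partial>M)
      = (\<Sum>k. \<integral>\<^sup>+x. ennreal (2^k * (cmod (?d k x))\<^sup>2) \<partial>M)"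
    by (intro nn_integral_suminf) measurable
  also have "\<dots> \<le> (\<Sum>k. ennreal ((1/2)^k))"
  proof (intro suminf_le)
    fix k
    have "(\<integral>\<^sup>+x. ennreal (2^k * (cmod (?d k x))\<^sup>2) \<partial>M) = ennreal (2^k * (L2_norm M (?d k))\<^sup>2)"
      using nn_integral_L2_norm[OF L2_space_diff[OF L2 L2], of "Suc k" k]
      by (simp add: ennreal_mult nn_integral_cmult)
    also have "\<dots> \<le> ennreal (2^k * ((1/2)^k)\<^sup>2)"
      using step by (intro ennreal_leI mult_left_mono power_mono L2_norm_nonneg) auto
    also have "2^k * ((1/2)^k)\<^sup>2 = (1/2::real)^k"
      by (simp add: power2_eq_square power_divide)
    finally show "(\<integral>\<^sup>+x. ennreal (2^k * (cmod (?d k x))\<^sup>2) \<partial>M) \<le> ennreal ((1/2)^k)" .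
  qed auto
  also have "\<dots> = ennreal (\<Sum>k. (1/2)^k)"
    by (intro suminf_ennreal2) (auto intro: summable_geometric)
  finally have "(\<integral>\<^sup>+x. (\<Sum>k. ennreal (2^k * (cmod (?d k x))\<^sup>2)) \<partial>M) \<noteq> \<infinity>"
    by (auto simp: top_unique)
  then have "AE x in M. (\<Sum>k. ennreal (2^k * (cmod (?d k x))\<^sup>2)) \<noteq> \<infinity>"
    by (intro nn_integral_PInf_AE) measurable
  then show ?thesis
  proof eventually_elim
    case (elim x)
    then have "summable (\<lambda>k. 2^k * (cmod (?d k x))\<^sup>2)"
      by (intro summable_suminf_not_top) auto
    then have "summable (\<lambda>k. 2^k * (cmod (?d k x))\<^sup>2 + (1/2)^k)"
      by (intro summable_add summable_geometric) auto
    then have "summable (\<lambda>k. ?d k x)"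
    proof (rule summable_comparison_test')
      fix k :: nat
      let ?a = "cmod (?d k x)"
      have "0 \<le> 2^k * (?a - (1/2)^k)\<^sup>2" by simp
      also have "\<dots> = 2^k * ?a\<^sup>2 + (1/2)^k - 2 * ?a"
        by (simp add: power2_eq_square power_divide field_simps)
      finally show "norm (?d k x) \<le> 2^k * ?a\<^sup>2 + (1/2)^k"
        using norm_ge_zero[of "?d k x"] by linarith
    qed
    then have "convergent (\<lambda>n. \<Sum>k<n. ?d k x)"
      by (simp add: summable_iff_convergent)
    from convergent_add[OF this convergent_const[of "v 0 x"]] show ?case
      by (simp add: sum_lessThan_telescope[of "\<lambda>k. v k x"])
  qed
qed

text \<open>
  A subsequence with geometrically small increments converges almost everywhere to some \<open>g\<close>.
  Fatou's lemma along this subsequence bounds the distance of \<open>u n\<close> to \<open>g\<close> by the distances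
  of \<open>u n\<close> to late members of the sequence, so the whole sequence converges to \<open>g\<close>.
\<close>

lemma L2_complete:
  assumes L2: "\<And>n. u n \<in> L2_space M"
    and Cauchy: "\<And>e. e > 0 \<Longrightarrow> \<exists>N. \<forall>m\<ge>N. \<forall>n\<ge>N. L2_norm M (\<lambda>x. u m x - u n x) \<le> e"
  obtains g where "g \<in> L2_space M" "L2_tendsto M u g sequentially"
proof -
  note [measurable] = L2[THEN L2_space_measurable]
  have "\<forall>k. \<exists>N. \<forall>m\<ge>N. \<forall>n\<ge>N. L2_norm M (\<lambda>x. u m x - u n x) \<le> (1/2)^k"
    using Cauchy by simp
  then obtain r where r: "\<And>k m n. m \<ge> r k \<Longrightarrow> n \<ge> r k \<Longrightarrow> L2_norm M (\<lambda>x. u m x - u n x) \<le> (1/2)^k"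
    by metis
  \<comment> \<open>The sum makes the indices monotone while keeping \<open>R l \<ge> r k\<close> for \<open>k \<le> l\<close>.\<close>
  define R where "R k = (\<Sum>i\<le>k. r i)" for k
  have R: "r k \<le> R l" if "k \<le> l" for k l
    unfolding R_def using that by (intro member_le_sum) auto
  define g where "g x = lim (\<lambda>k. u (R k) x)" for x
  have [measurable]: "g \<in> borel_measurable M"
    unfolding g_def by (intro borel_measurable_lim_metric) measurable
  have lim: "AE x in M. (\<lambda>k. u (R k) x) \<longlonglongrightarrow> g x"
  proof -
    have "AE x in M. convergent (\<lambda>k. u (R k) x)"
      using L2 R r by (intro AE_convergent_if_rapidly_Cauchy) auto
    then show ?thesis
      by eventually_elim (simp add: g_def convergent_LIMSEQ_iff)
  qed
  have bound: "(\<integral>\<^sup>+x. ennreal ((cmod (u n x - g x))\<^sup>2) \<partial>M) \<le> ennreal (((1/2)^k)\<^sup>2)" if n: "n \<ge> r k" for n k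
  proof -
    have "(\<integral>\<^sup>+x. ennreal ((cmod (u n x - g x))\<^sup>2) \<partial>M)
        = (\<integral>\<^sup>+x. liminf (\<lambda>l. ennreal ((cmod (u n x - u (R l) x))\<^sup>2)) \<partial>M)"
    proof (rule nn_integral_cong_AE, use lim in eventually_elim)
      case (elim x)
      have "(\<lambda>l. ennreal ((cmod (u n x - u (R l) x))\<^sup>2)) \<longlonglongrightarrow> ennreal ((cmod (u n x - g x))\<^sup>2)"
        by (intro tendsto_ennrealI tendsto_intros elim)
      then show ?case
        by (intro lim_imp_Liminf[symmetric]) simp_all
    qed
    also have "\<dots> \<le> liminf (\<lambda>l. \<integral>\<^sup>+x. ennreal ((cmod (u n x - u (R l) x))\<^sup>2) \<partial>M)"
      by (intro nn_integral_liminf) measurable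
    also have "\<dots> \<le> limsup (\<lambda>l. \<integral>\<^sup>+x. ennreal ((cmod (u n x - u (R l) x))\<^sup>2) \<partial>M)"
      by (intro Liminf_le_Limsup) auto
    also have "\<dots> \<le> ennreal (((1/2)^k)\<^sup>2)"
    proof (rule Limsup_bounded)
      show "\<forall>\<^sub>F l in sequentially.
          (\<integral>\<^sup>+x. ennreal ((cmod (u n x - u (R l) x))\<^sup>2) \<partial>M) \<le> ennreal (((1/2)^k)\<^sup>2)"
        using eventually_ge_at_top[of k]
      proof eventually_elim
        case (elim l)
        show ?case
          unfolding nn_integral_L2_norm[OF L2_space_diff[OF L2 L2]]
          using n R[OF elim] by (intro ennreal_leI power_mono r L2_norm_nonneg)
      qed
    qed
    finally show ?thesis .
  qed
  have diff: "(\<lambda>x. u (r 0) x - g x) \<in> L2_space M"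
    by (rule L2_norm_bound_from_nn_integral(1)[OF _ _ bound]) auto
  have "g \<in> L2_space M"
    using L2_space_diff[OF L2[of "r 0"] diff] by simp
  moreover have "L2_tendsto M u g sequentially"
    unfolding L2_tendsto_def
  proof (rule LIMSEQ_I)
    fix e :: real assume "0 < e"
    then obtain k where k: "(1/2)^k < e"
      using real_arch_pow_inv[of e "1/2"] by auto
    have "L2_norm M (\<lambda>x. u n x - g x) \<le> (1/2)^k" if "n \<ge> r k" for n
      by (rule L2_norm_bound_from_nn_integral(2)[OF _ _ bound[OF that]]) auto
    then show "\<exists>no. \<forall>n\<ge>no. norm (L2_norm M (\<lambda>x. u n x - g x) - 0) < e"
      using k by (intro exI[of _ "r k"]) (auto simp: L2_norm_nonneg intro: le_less_trans)
  qed
  ultimately show thesis by (rule that)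
qed

text \<open>
  By the Pythagorean identity with \<open>f = 0\<close>, the squared distance of two partial sums is a
  block of the series \<open>\<Sum>j. \<bar>c j\<bar>\<^sup>2\<close>; hence the partial sums are Cauchy.
\<close>

lemma Riesz_Fischer:
  assumes on: "L2_orthonormal M \<phi>" and sum: "summable (\<lambda>j. (cmod (c (Suc j)))\<^sup>2)"
  obtains g where "g \<in> L2_space M" "L2_expansion M \<phi> c g"
proof -
  define s where "s N x = (\<Sum>j=1..N. c j * \<phi> j x)" for N x
  have s_L2: "s N \<in> L2_space M" for N
    unfolding s_def using on by (intro L2_space_sum) (auto simp: L2_orthonormal_def)
  have dist: "(L2_norm M (\<lambda>x. s m x - s n x))\<^sup>2 = (\<Sum>j=m..<n. (cmod (c (Suc j)))\<^sup>2)" if "m \<le> n" for m n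
  proof -
    have split: "s n x = s m x + (\<Sum>j\<in>{Suc m..n}. c j * \<phi> j x)" for x
      unfolding s_def using sum.ub_add_nat[of 1 m "\<lambda>j. c j * \<phi> j x" "n - m"] that by simp
    have "(L2_norm M (\<lambda>x. s m x - s n x))\<^sup>2
        = (L2_norm M (\<lambda>x. 0 - (\<Sum>j\<in>{Suc m..n}. c j * \<phi> j x)))\<^sup>2"
      by (simp add: split)
    also have "\<dots> = (\<Sum>j\<in>{Suc m..n}. (cmod (c j))\<^sup>2)"
      by (subst L2_norm_sq_residual[OF on L2_space_zero]) (auto simp: L2_inner_def L2_norm_def)
    also have "\<dots> = (\<Sum>j=m..<n. (cmod (c (Suc j)))\<^sup>2)"
      using sum.shift_bounds_Suc_ivl[of "\<lambda>j. (cmod (c j))\<^sup>2" m n]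
      unfolding atLeastLessThanSuc_atLeastAtMost .
    finally show ?thesis .
  qed
  have "\<exists>N. \<forall>m\<ge>N. \<forall>n\<ge>N. L2_norm M (\<lambda>x. s m x - s n x) \<le> e" if "e > 0" for e
  proof -
    obtain N where N: "\<And>m n. m \<ge> N \<Longrightarrow> norm (\<Sum>j=m..<n. (cmod (c (Suc j)))\<^sup>2) < e\<^sup>2"
      using sum \<open>e > 0\<close> unfolding summable_Cauchy by (metis zero_less_power)
    have le: "L2_norm M (\<lambda>x. s m x - s n x) \<le> e" if "N \<le> m" "m \<le> n" for m n
    proof (rule power2_le_imp_le)
      show "(L2_norm M (\<lambda>x. s m x - s n x))\<^sup>2 \<le> e\<^sup>2"
        using N[OF that(1), of n] dist[OF that(2)] by simp
    qed (use \<open>e > 0\<close> in simp)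
    have "L2_norm M (\<lambda>x. s m x - s n x) \<le> e" if "N \<le> m" "N \<le> n" for m n
    proof (cases "m \<le> n")
      case False
      have "L2_norm M (\<lambda>x. s m x - s n x) = L2_norm M (\<lambda>x. s n x - s m x)"
        by (simp add: L2_norm_def norm_minus_commute)
      then show ?thesis using False le[of n m] that by simp
    qed (use le that in simp)
    then show ?thesis by blast
  qed
  from L2_complete[OF s_L2 this] obtain g where g: "g \<in> L2_space M" "L2_tendsto M s g sequentially"
    by blast
  moreover have "s = (\<lambda>N x. \<Sum>j=1..N. c j * \<phi> j x)"
    by (simp add: s_def fun_eq_iff)
  ultimately show thesis
    by (intro that) (auto simp: L2_expansion_def)
qed

section \<open>The optimal design problem\<close>

text \<open>
  Everything follows from the step \<open>rigid\<close>: a unit vector whose functional reaches \<open>v\<close> has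
  squared coefficients dominating the weights \<open>v / \<gamma> j\<close>, and since both families have sum 1
  they agree. The upper bound is the same fact: a value at least \<open>v\<close> forces these
  coefficients, for which the value is exactly \<open>v\<close>.
\<close>

theorem optimal_design:
  fixes \<gamma> :: "nat \<Rightarrow> real"
  assumes basis: "L2_orthonormal_basis M \<phi>"
    and pos: "\<And>j. j \<ge> 1 \<Longrightarrow> 0 < \<gamma> j"
    and sum: "summable (\<lambda>j. 1 / \<gamma> (Suc j))"
  defines "v \<equiv> inverse (\<Sum>k. 1 / \<gamma> (Suc k))"
  shows "design_solutions M \<gamma> \<phi> \<noteq> {}"
    and "design_value M \<gamma> \<phi> = ereal v"
    and "design_solutions M \<gamma> \<phi> = {g \<in> L2_space M. \<exists>c. L2_expansion M \<phi> c g \<and>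
            (\<forall>j\<ge>1. (cmod (c j))\<^sup>2 = v * (1 / \<gamma> j))}" (is "_ = ?S")
proof -
  have on: "L2_orthonormal M \<phi>"
    using basis by (simp add: L2_orthonormal_def L2_orthonormal_basis_def)
  have S_pos: "0 < (\<Sum>k. 1 / \<gamma> (Suc k))"
    using sum pos by (intro suminf_pos) auto
  then have v_pos: "0 < v"
    by (simp add: v_def)
  have weights: "(\<lambda>j. v * (1 / \<gamma> (Suc j))) sums 1"
    using sums_mult[OF summable_sums[OF sum], of v] S_pos by (simp add: v_def)
  define a where "a g j = (cmod (L2_inner M g (\<phi> j)))\<^sup>2" for g j
  have functional: "design_functional M \<gamma> \<phi> g = (INF j\<in>{1..}. ereal (\<gamma> j * a g j))" for g
    by (simp add: design_functional_def a_def)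
  have a_sums: "(\<lambda>j. a g (Suc j)) sums 1" if "g \<in> L2_unit_sphere M" for g
    using Parseval[OF basis, of g] that by (simp add: L2_unit_sphere_def a_def)
  have rigid: "a g j = v * (1 / \<gamma> j)"
    if g: "g \<in> L2_unit_sphere M" and ge: "ereal v \<le> design_functional M \<gamma> \<phi> g" and "1 \<le> j" for g j
  proof -
    have le: "v * (1 / \<gamma> i) \<le> a g i" if "1 \<le> i" for i
    proof -
      have "ereal v \<le> ereal (\<gamma> i * a g i)"
        using ge unfolding functional by (rule order.trans) (use that in \<open>auto intro: INF_lower\<close>)
      then show ?thesis
        using pos[OF that] by (simp add: field_simps)
    qed
    have "(\<lambda>i. a g (Suc i) - v * (1 / \<gamma> (Suc i))) sums 0"
      using sums_diff[OF a_sums[OF g] weights] by simp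
    then have "\<forall>i. a g (Suc i) - v * (1 / \<gamma> (Suc i)) = 0"
      using le suminf_eq_zero_iff[of "\<lambda>i. a g (Suc i) - v * (1 / \<gamma> (Suc i))"]
      by (auto simp: sums_iff)
    then show ?thesis
      using \<open>1 \<le> j\<close> by (cases j) auto
  qed
  have attained: "design_functional M \<gamma> \<phi> g = ereal v"
    if "\<And>j. 1 \<le> j \<Longrightarrow> a g j = v * (1 / \<gamma> j)" for g
  proof -
    have "\<gamma> j * a g j = v" if "j \<in> {1..}" for j
      using pos[of j] that \<open>\<And>j. 1 \<le> j \<Longrightarrow> a g j = v * (1 / \<gamma> j)\<close>[of j] by simp
    then show ?thesis
      unfolding functional by (subst INF_cong[OF refl, where D="\<lambda>_. ereal v"]) auto
  qed
  have upper: "design_functional M \<gamma> \<phi> g \<le> ereal v" if "g \<in> L2_unit_sphere M" for g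
  proof (cases "ereal v \<le> design_functional M \<gamma> \<phi> g")
    case True
    show ?thesis
      using attained[OF rigid[OF that True]] by simp
  qed simp
  have S_iff: "g \<in> ?S \<longleftrightarrow> g \<in> L2_unit_sphere M \<and> (\<forall>j\<ge>1. a g j = v * (1 / \<gamma> j))" for g
  proof
    assume "g \<in> ?S"
    then obtain c where g: "g \<in> L2_space M" and exp: "L2_expansion M \<phi> c g"
      and c: "\<And>j. j \<ge> 1 \<Longrightarrow> (cmod (c j))\<^sup>2 = v * (1 / \<gamma> j)"
      by blast
    have a: "a g j = v * (1 / \<gamma> j)" if "1 \<le> j" for j
      using c[OF that] unfolding a_def L2_expansion_coeff[OF on g exp that] .
    have "(L2_norm M g)\<^sup>2 = 1"
      using sums_unique2[OF Parseval[OF basis g]] weights a by (simp add: a_def)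
    then have "L2_norm M g = 1"
      using L2_norm_nonneg[of M g] by (simp add: power2_eq_1_iff)
    with a g show "g \<in> L2_unit_sphere M \<and> (\<forall>j\<ge>1. a g j = v * (1 / \<gamma> j))"
      by (simp add: L2_unit_sphere_def)
  next
    assume "g \<in> L2_unit_sphere M \<and> (\<forall>j\<ge>1. a g j = v * (1 / \<gamma> j))"
    then show "g \<in> ?S"
      using L2_expansion_Fourier[OF basis, of g] by (auto simp: L2_unit_sphere_def a_def)
  qed
  have "?S \<noteq> {}"
  proof -
    \<comment> \<open>Only the moduli are prescribed; the nonnegative real choice of phase will do.\<close>
    define c where "c j = complex_of_real (sqrt (v * (1 / \<gamma> j)))" for j
    have c: "(cmod (c j))\<^sup>2 = v * (1 / \<gamma> j)" if "1 \<le> j" for j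
      using v_pos pos[OF that] by (simp add: c_def del: times_divide_eq_right)
    then have "summable (\<lambda>j. (cmod (c (Suc j)))\<^sup>2)"
      using weights by (simp add: sums_iff)
    from Riesz_Fischer[OF on this] obtain g where "g \<in> L2_space M" "L2_expansion M \<phi> c g" .
    with c show ?thesis by blast
  qed
  then obtain g where g: "g \<in> L2_unit_sphere M" "design_functional M \<gamma> \<phi> g = ereal v"
    using S_iff attained by blast
  show val: "design_value M \<gamma> \<phi> = ereal v"
    unfolding design_value_def
  proof (rule antisym)
    show "(SUP g\<in>L2_unit_sphere M. design_functional M \<gamma> \<phi> g) \<le> ereal v"
      by (intro SUP_least upper)
    show "ereal v \<le> (SUP g\<in>L2_unit_sphere M. design_functional M \<gamma> \<phi> g)"
      using g by (metis SUP_upper)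
  qed
  show "design_solutions M \<gamma> \<phi> = ?S"
  proof (rule set_eqI)
    show "h \<in> design_solutions M \<gamma> \<phi> \<longleftrightarrow> h \<in> ?S" for h
      unfolding S_iff unfolding design_solutions_def val using rigid attained by auto
  qed
  with \<open>?S \<noteq> {}\<close> show "design_solutions M \<gamma> \<phi> \<noteq> {}" by simp
qed

text \<open>
  Division by zero gives zero, so positivity says precisely that \<open>\<theta> j\<close> is not
  almost everywhere zero. It could not be, because its pairing with an exponential is 1.
\<close>

lemma gamma_coeff_pos:
  assumes bi: "biorthogonal_to_exponentials T lam \<theta>" and "1 \<le> j"
  shows "0 < gamma_coeff T lam \<theta> j"
proof -
  let ?L = "lebesgue_on {0<..<T}"
  have int: "integrable ?L (\<lambda>t. (cmod (\<theta> j t))\<^sup>2)"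
    and one: "(LINT t|?L. exp (- lam j * complex_of_real t) * \<theta> j t) = 1"
    using bi \<open>1 \<le> j\<close> by (auto simp: biorthogonal_to_exponentials_def L2_space_def)
  have "(LINT t|?L. (cmod (\<theta> j t))\<^sup>2) \<noteq> 0"
  proof
    assume "(LINT t|?L. (cmod (\<theta> j t))\<^sup>2) = 0"
    then have "AE t in ?L. \<theta> j t = 0"
      using integral_nonneg_eq_0_iff_AE[OF int] by simp
    then have "(LINT t|?L. exp (- lam j * complex_of_real t) * \<theta> j t) = 0"
      by (intro integral_eq_zero_AE) auto
    with one show False by simp
  qed
  moreover have "0 \<le> (LINT t|?L. (cmod (\<theta> j t))\<^sup>2)"
    by simp
  ultimately have "0 < (LINT t|?L. (cmod (\<theta> j t))\<^sup>2)"
    by linarith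
  then show ?thesis
    unfolding gamma_coeff_def by (intro divide_pos_pos) auto
qed

theorem theorem4:
  fixes T :: real
    and \<Omega> :: "(real ^ 'n) set"
    and D :: "(real ^ 'n \<Rightarrow> complex) set"
    and A\<^sub>0 :: "(real ^ 'n \<Rightarrow> complex) \<Rightarrow> (real ^ 'n \<Rightarrow> complex)"
    and \<phi> :: "nat \<Rightarrow> real ^ 'n \<Rightarrow> complex"
    and lam :: "nat \<Rightarrow> complex"
    and \<theta> :: "nat \<Rightarrow> real \<Rightarrow> complex"
  assumes "T > 0"
    and "open \<Omega>" and "connected \<Omega>"
    and "L2_densely_defined_operator (lebesgue_on \<Omega>) D A\<^sub>0"
    and "generates_L2_C0_semigroup (lebesgue_on \<Omega>) D (\<lambda>f x. - A\<^sub>0 f x)"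
    and "L2_orthonormal_basis (lebesgue_on \<Omega>) \<phi>"
    and "\<And>j. j \<ge> 1 \<Longrightarrow> L2_eigenfunction (lebesgue_on \<Omega>) D A\<^sub>0 (lam j) (\<phi> j)"
    and "\<And>j k. 1 \<le> j \<Longrightarrow> j \<le> k \<Longrightarrow> Re (lam j) \<le> Re (lam k)"
    and "biorthogonal_to_exponentials T lam \<theta>"
    and "summable (\<lambda>j. 1 / gamma_coeff T lam \<theta> (Suc j))"
  shows "design_solutions (lebesgue_on \<Omega>) (gamma_coeff T lam \<theta>) \<phi> \<noteq> {} \<and>
         design_value (lebesgue_on \<Omega>) (gamma_coeff T lam \<theta>) \<phi>
           = ereal (inverse (\<Sum>k. 1 / gamma_coeff T lam \<theta> (Suc k))) \<and>
         design_solutions (lebesgue_on \<Omega>) (gamma_coeff T lam \<theta>) \<phi> =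
           {g \<in> L2_space (lebesgue_on \<Omega>). \<exists>c. L2_expansion (lebesgue_on \<Omega>) \<phi> c g \<and>
              (\<forall>j\<ge>1. (cmod (c j))\<^sup>2 =
                 inverse (\<Sum>k. 1 / gamma_coeff T lam \<theta> (Suc k)) * (1 / gamma_coeff T lam \<theta> j))}"
  using optimal_design[OF assms(6) gamma_coeff_pos[OF assms(9)] assms(10)] by blast

end
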